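(* There exists an infinite family of DAGs $G=(V,E)$ with $|V|$ unbounded, each of width $\alpha_1=2$, such that on each of them (an execution of) the greedy chain partition algorithm outputs at least $\alpha_1\log_4(|V|)=2\log_4(|V|)$ chains. Likewise, there exists an infinite family of DAGs $G=(V,E)$ with $|V|$ unbounded, each of height $\beta_1=2$, such that on each of them (an execution of) the greedy antichain partition algorithm outputs at least $\beta_1\log_4(|V|)=2\log_4(|V|)$ antichains.
   Context: Let $G=(V,E)$ be a directed acyclic graph. A chain is a set of vertices that occur, in order, as a subsequence of the vertices of some directed path of $G$. An antichain is a set of vertices that are pairwise unreachable from one another. The width $\alpha_1$ is the maximum size of an antichain, which equals the minimum number of chains in a partition of $V$ into chains (MCP). The height $\beta_1$ is the maximum size of a chain, which equals the minimum number of antichains in a partition of $V$ into antichains (MAP). The greedy chain partition algorithm maintains the set $U$ of uncovered vertices (initially $U=V$) and, while $U\neq\emptyset$, selects a chain $C\subseteq U$ of maximum size (ties broken arbitrarily), outputs it and removes it from $U$; the greedy antichain partition algorithm is identical with antichains in place of chains. *)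

theory Defs
  imports
    Complex_Main
    "HOL-Library.Sublist"
    "Graph_Theory.Pair_Digraph"
    "Graph_Theory.Vertex_Walk"
begin

locale dag = pair_fin_digraph G for G :: "'a pair_pre_digraph" +
  assumes no_cycle: "\<not> cycle c"

definition chain :: "'a pair_pre_digraph \<Rightarrow> 'a set \<Rightarrow> bool" where
  "chain G C \<longleftrightarrow> (\<exists>p xs. vpath p (with_proj G) \<and> subseq xs p \<and> C = set xs)"

definition antichain :: "'a pair_pre_digraph \<Rightarrow> 'a set \<Rightarrow> bool" where
  "antichain G A \<longleftrightarrow> A \<subseteq> pverts G \<and>
     (\<forall>u\<in>A. \<forall>v\<in>A. u \<noteq> v \<longrightarrow> \<not> u \<rightarrow>\<^sup>*\<^bsub>with_proj G\<^esub> v)"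

definition width :: "'a pair_pre_digraph \<Rightarrow> nat" where
  "width G = Max (card ` {A. antichain G A})"

definition height :: "'a pair_pre_digraph \<Rightarrow> nat" where
  "height G = Max (card ` {C. chain G C})"

text \<open>
  \<open>greedy_run P U Xs\<close>: started with uncovered set \<open>U\<close>, some execution of the greedy
  algorithm for sets with property \<open>P\<close> outputs \<open>Xs\<close>, in this order. Ties are broken
  arbitrarily, so the relation is not functional in \<open>Xs\<close>.
\<close>

inductive greedy_run :: "('a set \<Rightarrow> bool) \<Rightarrow> 'a set \<Rightarrow> 'a set list \<Rightarrow> bool" for P where
  stop: "greedy_run P {} []"
| step: "U \<noteq> {} \<Longrightarrow> is_arg_max card (\<lambda>Y. Y \<subseteq> U \<and> P Y) X \<Longrightarrow> greedy_run P (U - X) Xs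
    \<Longrightarrow> greedy_run P U (X # Xs)"

definition greedy_chain_partition :: "'a pair_pre_digraph \<Rightarrow> 'a set list \<Rightarrow> bool" where
  "greedy_chain_partition G Cs \<longleftrightarrow> greedy_run (chain G) (pverts G) Cs"

definition greedy_antichain_partition :: "'a pair_pre_digraph \<Rightarrow> 'a set list \<Rightarrow> bool" where
  "greedy_antichain_partition G As \<longleftrightarrow> greedy_run (antichain G) (pverts G) As"

end

theory Submission
  imports Defs "HOL-Library.Countable" "HOL-Library.Disjoint_Sets"
begin

text \<open>
  For chains, take the poset of all triples \<open>(t, r, s)\<close> with \<open>r \<le> t \<le> m\<close> and \<open>s < t choose r\<close>.
  The triples of level \<open>t\<close> form a chain of size \<open>2 ^ t\<close>, traversed block by block with \<open>r\<close>
  increasing, and the blocks with \<open>r\<close> of fixed parity form a chain when sorted by increasing \<open>r\<close>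
  and then by decreasing \<open>t\<close>; hence the width is at most 2. Merging these relations, triples
  are incomparable only if \<open>r\<close> increases by one while \<open>t\<close> increases. Restricted to
  levels up to \<open>t\<close>, the position of an element in its parity chain is strictly monotone with
  values below \<open>2 ^ t\<close>, so level \<open>t\<close> is a longest chain there, and greedy may
  take the levels \<open>m, \<dots>, 0\<close> one after the other: \<open>m + 1\<close> chains on \<open>2 ^ (m + 1) - 1\<close> vertices.

  For antichains, take a bipartite order whose two sides are split into levels of sizes
  \<open>1, 1, 2, 4, \<dots>, 2 ^ (m - 1)\<close>, with \<open>a < b\<close> for \<open>a\<close> on the lower and \<open>b\<close> on the upper side
  whenever their levels differ. A mixed antichain lies within one level, so the top remaining level
  (both sides) always ties with a whole side: \<open>m + 1\<close> antichains on \<open>2 ^ (m + 1)\<close> vertices.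
\<close>

section \<open>Graphs of finite strict orders\<close>

text \<open>The families consist of graphs on natural numbers, so vertices are encoded by the
  injective \<open>to_nat\<close>, which preserves all cardinalities. Every related pair becomes an
  arc; for transitive \<open>R\<close>, reachability thus adds only reflexivity.\<close>

definition order_graph :: "'a::countable set \<Rightarrow> ('a \<Rightarrow> 'a \<Rightarrow> bool) \<Rightarrow> nat pair_pre_digraph" where
  "order_graph V R = \<lparr>pverts = to_nat ` V,
     parcs = {(to_nat u, to_nat v) | u v. u \<in> V \<and> v \<in> V \<and> R u v}\<rparr>"

lemma pverts_order_graph [simp]: "pverts (order_graph V R) = to_nat ` V"
  by (simp add: order_graph_def)

lemma in_parcs_order_graph [simp]:
  "(to_nat u, to_nat v) \<in> parcs (order_graph V R) \<longleftrightarrow> u \<in> V \<and> v \<in> V \<and> R u v"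
  by (auto simp: order_graph_def)

lemma parcs_order_graphE:
  assumes "(a, b) \<in> parcs (order_graph V R)"
  obtains u v where "a = to_nat u" "b = to_nat v" "u \<in> V" "v \<in> V" "R u v"
  using assms by (auto simp: order_graph_def)

lemma card_pverts_order_graph: "card (pverts (order_graph V R)) = card V"
  by (simp add: card_image)

lemma trancl_parcs_order_graph:
  assumes "transp R" "(a, b) \<in> (parcs (order_graph V R))\<^sup>+"
  shows "(a, b) \<in> parcs (order_graph V R)"
  using assms(2)
proof induction
  case (step b c)
  then show ?case
    by (elim parcs_order_graphE) (auto dest: transpD[OF assms(1)])
qed

text \<open>A cycle would put a pair \<open>(u, u)\<close> into the transitive closure of the arcs,
  hence among the arcs themselves, against irreflexivity.\<close>

lemma dag_order_graph:
  assumes "finite V" "transp R" "irreflp R"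
  shows "dag (order_graph V R)"
proof -
  let ?G = "order_graph V R"
  have "parcs ?G \<subseteq> pverts ?G \<times> pverts ?G"
    by (auto simp: order_graph_def)
  then have "finite (parcs ?G)"
    by (rule finite_subset) (simp add: assms(1))
  then interpret pair_fin_digraph ?G
    by unfold_locales (use assms(1) in \<open>auto simp: order_graph_def\<close>)
  show ?thesis
  proof
    fix c
    show "\<not> cycle c"
    proof
      assume "cycle c"
      then obtain u where "awalk u c u" "c \<noteq> []"
        by (auto simp: cycle_def)
      then have "(u, u) \<in> (parcs ?G)\<^sup>+"
        using reachable1_awalk by auto
      then have "(u, u) \<in> parcs ?G"
        by (rule trancl_parcs_order_graph[OF assms(2)])
      then show False
        using assms(3) by (auto elim!: parcs_order_graphE dest: irreflpD)
    qed
  qed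
qed

section \<open>Antichains and chains of an order graph\<close>

lemma antichain_order_graph_iff:
  assumes "transp R" "irreflp R"
  shows "antichain (order_graph V R) X \<longleftrightarrow>
    (\<exists>Y \<subseteq> V. X = to_nat ` Y \<and> (\<forall>u\<in>Y. \<forall>v\<in>Y. \<not> R u v))"
proof -
  let ?G = "order_graph V R"
  have reach: "to_nat u \<rightarrow>\<^sup>*\<^bsub>with_proj ?G\<^esub> to_nat v \<longleftrightarrow> u = v \<or> R u v"
    if "u \<in> V" "v \<in> V" for u v :: 'a
  proof -
    interpret pair_wf_digraph ?G
      by unfold_locales (auto simp: order_graph_def)
    show ?thesis
      using that trancl_parcs_order_graph[OF assms(1), of "to_nat u" "to_nat v" V]
      by (auto simp: reachable_conv rtrancl_eq_or_trancl)
  qed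
  show ?thesis
  proof
    assume X: "antichain ?G X"
    then obtain Y where Y: "Y \<subseteq> V" "X = to_nat ` Y"
      by (auto simp: antichain_def subset_image_iff)
    have "\<not> R u v" if "u \<in> Y" "v \<in> Y" for u v
      using X Y that reach[of u v] assms(2)
      by (cases "u = v") (auto simp: antichain_def dest: irreflpD)
    with Y show "\<exists>Y \<subseteq> V. X = to_nat ` Y \<and> (\<forall>u\<in>Y. \<forall>v\<in>Y. \<not> R u v)"
      by blast
  next
    assume "\<exists>Y \<subseteq> V. X = to_nat ` Y \<and> (\<forall>u\<in>Y. \<forall>v\<in>Y. \<not> R u v)"
    then show "antichain ?G X"
      using reach by (auto simp: antichain_def subset_iff)
  qed
qed

text \<open>A minimal element lies below all others by totality, so it can head a sorted list of the
  rest.\<close>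

lemma ex_sorted_wrt_list:
  assumes "finite X" "transp R" "irreflp R" "totalp_on X R"
  shows "\<exists>xs. set xs = X \<and> sorted_wrt R xs \<and> distinct xs"
  using assms(1,4)
proof (induction rule: finite_psubset_induct)
  case (psubset X)
  show ?case
  proof (cases "X = {}")
    case False
    have "asymp R"
      using assms(2,3) by (blast intro: asympI dest: transpD irreflpD)
    then obtain m where m: "m \<in> X" "\<forall>x\<in>X. x \<noteq> m \<longrightarrow> \<not> R x m"
      using Finite_Set.bex_min_element[of X R] psubset.hyps False assms(2)
      by (metis asymp_on_subset transp_on_subset subset_UNIV)
    have "totalp_on (X - {m}) R"
      using psubset.prems by (rule totalp_on_subset) auto
    then obtain xs where xs: "set xs = X - {m}" "sorted_wrt R xs" "distinct xs"
      using psubset.IH[of "X - {m}"] m(1) by blast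
    have "\<forall>x\<in>set xs. R m x"
      using m xs(1) psubset.prems by (auto dest: totalp_onD)
    then have "set (m # xs) = X \<and> sorted_wrt R (m # xs) \<and> distinct (m # xs)"
      using xs m(1) by auto
    then show ?thesis by blast
  qed auto
qed

text \<open>The sorted list of \<open>Y\<close> is itself a path, as neighbours in it are joined by
  arcs. \<open>Y\<close> is nonempty because a path has at least one vertex.\<close>

lemma chain_order_graphI:
  assumes "finite V" "transp R" "irreflp R" "Y \<subseteq> V" "Y \<noteq> {}" "totalp_on Y R"
  shows "chain (order_graph V R) (to_nat ` Y)"
proof -
  obtain xs where xs: "set xs = Y" "sorted_wrt R xs" "distinct xs"
    using ex_sorted_wrt_list[of Y R] assms finite_subset by blast
  have "set (vwalk_arcs (map to_nat xs)) \<subseteq> parcs (order_graph V R)"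
    if "set xs \<subseteq> V" "sorted_wrt R xs" for xs
    using that by (induction xs rule: induct_list012) auto
  then have "vpath (map to_nat xs) (with_proj (order_graph V R))"
    using xs assms(4,5) by (auto simp: vpath_def vwalk_def distinct_map)
  then show ?thesis
    unfolding chain_def using xs(1)
    by (intro exI[of _ "map to_nat xs"]) auto
qed

text \<open>By transitivity any two vertices of a path are related, and this passes to every subset
  of its vertices.\<close>

lemma chain_order_graphE:
  assumes "chain (order_graph V R) X" "transp R"
  obtains Y where "Y \<subseteq> V" "X = to_nat ` Y" "totalp_on Y R"
proof -
  let ?E = "parcs (order_graph V R)"
  obtain p xs where p: "vpath p (with_proj (order_graph V R))" "subseq xs p" "X = set xs"
    using assms(1) by (auto simp: chain_def)
  have tr: "trans ?E"
    by (meson trancl_parcs_order_graph[OF assms(2)] r_into_trancl trancl_trans transI)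
  have "sorted_wrt (\<lambda>a b. (a, b) \<in> ?E) p" if "set (vwalk_arcs p) \<subseteq> ?E" for p
    using that by (induction p rule: induct_list012) (auto dest: transD[OF tr])
  then have "sorted_wrt (\<lambda>a b. (a, b) \<in> ?E) p"
    using p(1) by (auto simp: vpath_def vwalk_def)
  then have "totalp_on (set p) (\<lambda>a b. (a, b) \<in> ?E)"
    by (induction p) (auto simp: totalp_on_def)
  moreover have "X \<subseteq> set p"
    using p(2,3) by (auto simp: subseq_conv_nths dest: in_set_nthsD)
  ultimately have total: "totalp_on X (\<lambda>a b. (a, b) \<in> ?E)"
    by (blast intro: totalp_on_subset)
  have "X \<subseteq> to_nat ` V"
    using p(1) \<open>X \<subseteq> set p\<close> by (auto simp: vpath_def vwalk_def)
  then obtain Y where Y: "Y \<subseteq> V" "X = to_nat ` Y"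
    by (auto simp: subset_image_iff)
  moreover have "totalp_on Y R"
    using total Y by (auto simp: totalp_on_def)
  ultimately show thesis by (rule that)
qed

section \<open>Width and height from a bound and a witness\<close>

lemma width_eqI:
  assumes "finite (pverts G)" "\<And>X. antichain G X \<Longrightarrow> card X \<le> k" "antichain G A" "card A = k"
  shows "width G = k"
  unfolding width_def
proof (rule Max_eqI)
  have "{A. antichain G A} \<subseteq> Pow (pverts G)"
    by (auto simp: antichain_def)
  then show "finite (card ` {A. antichain G A})"
    using assms(1) by (meson finite_Pow_iff finite_imageI finite_subset)
qed (use assms in auto)

lemma height_eqI:
  assumes "finite (pverts G)" "\<And>X. chain G X \<Longrightarrow> card X \<le> k" "chain G C" "card C = k"
  shows "height G = k"
  unfolding height_def
proof (rule Max_eqI)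
  have "{C. chain G C} \<subseteq> Pow (pverts G)"
    by (auto simp: chain_def vpath_def vwalk_def subseq_conv_nths dest: in_set_nthsD)
  then show "finite (card ` {C. chain G C})"
    using assms(1) by (meson finite_Pow_iff finite_imageI finite_subset)
qed (use assms in auto)

section \<open>Greedy runs along levels\<close>

text \<open>The highest remaining \<open>C t\<close> is optimal by the last assumption, and
  disjointness ensures that removing it leaves the lower sets intact for the induction.\<close>

lemma greedy_run_levels:
  assumes "disjoint_family C"
    and "\<And>t. t < n \<Longrightarrow> C t \<noteq> {}" "\<And>t. t < n \<Longrightarrow> P (C t)"
    and "\<And>t X. t < n \<Longrightarrow> X \<subseteq> (\<Union>s\<le>t. C s) \<Longrightarrow> P X \<Longrightarrow> card X \<le> card (C t)"
  shows "greedy_run P (\<Union>t<n. C t) (map C (rev [0..<n]))"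
  using assms(2-4)
proof (induction n)
  case 0
  show ?case by (simp add: greedy_run.stop)
next
  case (Suc n)
  have "C n \<inter> C t = {}" if "t < n" for t
    using assms(1) that by (simp add: disjoint_family_on_def)
  then have rest: "(\<Union>t<Suc n. C t) - C n = (\<Union>t<n. C t)"
    by (auto simp: lessThan_Suc)
  have "greedy_run P (\<Union>t<n. C t) (map C (rev [0..<n]))"
    by (rule Suc.IH) (use Suc.prems in auto)
  moreover have "is_arg_max card (\<lambda>Y. Y \<subseteq> (\<Union>t<Suc n. C t) \<and> P Y) (C n)"
    using Suc.prems by (auto simp: is_arg_max_linorder lessThan_Suc_atMost)
  moreover have "(\<Union>t<Suc n. C t) \<noteq> {}"
    using Suc.prems(1)[of n] by (auto simp: lessThan_Suc)
  ultimately show ?case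
    using rest by (auto intro: greedy_run.step)
qed

lemma infinite_if_card_pverts_unbounded:
  assumes "\<And>N. \<exists>G\<in>F. N \<le> card (pverts G)"
  shows "infinite F"
proof
  assume "finite F"
  moreover obtain G where "G \<in> F" "Suc (Max ((\<lambda>G. card (pverts G)) ` F)) \<le> card (pverts G)"
    using assms by blast
  ultimately show False
    using Max_ge[of "(\<lambda>G. card (pverts G)) ` F" "card (pverts G)"] by fastforce
qed

lemma card_le_2I:
  assumes "\<And>x y z. x \<in> Y \<Longrightarrow> y \<in> Y \<Longrightarrow> z \<in> Y \<Longrightarrow> x \<noteq> y \<Longrightarrow> y \<noteq> z \<Longrightarrow> x \<noteq> z \<Longrightarrow> False"
  shows "card Y \<le> 2"
proof (rule ccontr)
  assume "\<not> card Y \<le> 2"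
  then obtain T where "T \<subseteq> Y" "card T = 3"
    using obtain_subset_with_card_n[of 3 Y] by auto
  then show False
    using assms by (auto simp: card_3_iff)
qed

lemma two_times_log_4_le:
  assumes "n \<le> 2 ^ k"
  shows "2 * log 4 (real n) \<le> real k"
proof (cases "n = 0")
  case False
  have "log 4 (real n) = log 2 (real n) / 2"
    using log_base_pow[of 2 2 "real n"] by simp
  moreover have "real n \<le> 2 ^ k"
    using of_nat_mono[OF assms, where 'a = real] by simp
  then have "log 2 (real n) \<le> log 2 (2 ^ k)"
    using False by (subst log_le_cancel_iff) auto
  ultimately show ?thesis by simp
\<comment> \<open>For \<open>n = 0\<close> the logarithm takes its default value 0.\<close>
qed (simp add: log_def)

section \<open>A width-2 order with long greedy chain partitions\<close>

fun zless :: "nat \<times> nat \<times> nat \<Rightarrow> nat \<times> nat \<times> nat \<Rightarrow> bool" where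
  "zless (t, r, s) (t', r', s') \<longleftrightarrow> r + 2 \<le> r' \<or>
     r \<le> r' \<and> r' \<le> r + 1 \<and> (t' < t \<or> t' = t \<and> (r < r' \<or> s < s'))"

text \<open>Binomial block sizes give level \<open>t\<close> exactly \<open>2 ^ t\<close> elements
  and let Pascal's rule relate blocks of neighbouring \<open>r\<close>.\<close>

definition zlevel :: "nat \<Rightarrow> (nat \<times> nat \<times> nat) set" where
  "zlevel t = {t} \<times> (SIGMA r:{..t}. {..<t choose r})"

definition zgraph :: "nat \<Rightarrow> nat pair_pre_digraph" where
  "zgraph m = order_graph (\<Union>t<Suc m. zlevel t) zless"

lemma transp_zless: "transp zless"
  by (rule transpI) auto

lemma irreflp_zless: "irreflp zless"
  by (rule irreflpI) auto

text \<open>Within one level the relation is the lexicographic order on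
  \<open>(r, s)\<close>.\<close>

lemma totalp_on_zlevel: "totalp_on (zlevel t) zless"
  by (auto simp: totalp_on_def zlevel_def)

lemma finite_zlevel: "finite (zlevel t)"
  by (simp add: zlevel_def)

lemma card_zlevel: "card (zlevel t) = 2 ^ t"
  by (simp add: zlevel_def card_cartesian_product choose_row_sum)

lemma disjoint_family_zlevel: "disjoint_family zlevel"
  by (auto simp: disjoint_family_on_def zlevel_def)

text \<open>
  The position of an element among those of levels up to \<open>t\<close> whose middle coordinate has the
  same parity, counted from 1 in the odd case: by Pascal's rule and the hockey-stick identity, the
  sum counts the elements with smaller middle coordinate, and the difference those with equal
  middle coordinate and higher level.
\<close>
fun zrank :: "nat \<Rightarrow> nat \<times> nat \<times> nat \<Rightarrow> nat" where
  "zrank t (u, r, s) =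
     (\<Sum>j<r. t choose j) + ((Suc t choose Suc r) - (Suc u choose Suc r)) + s"

section \<open>Ranks bound the size of chains\<close>

lemma sum_choose_le: "(\<Sum>j<k. t choose j) \<le> 2 ^ t"
proof (cases "k \<le> Suc t")
  case True
  then have "(\<Sum>j<k. t choose j) \<le> (\<Sum>j\<le>t. t choose j)"
    by (intro sum_mono2) auto
  then show ?thesis by (simp add: choose_row_sum)
next
  case False
  then have "(\<Sum>j<k. t choose j) = (\<Sum>j\<le>t. t choose j)"
    by (intro sum.mono_neutral_right) auto
  then show ?thesis by (simp add: choose_row_sum)
qed

lemma zrank_less:
  assumes "u \<le> t" "s < u choose r"
  shows "zrank t (u, r, s) < 2 ^ t"
proof -
  have "Suc u choose Suc r \<le> Suc t choose Suc r"
    using assms(1) by (intro binomial_right_mono) simp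
  \<comment> \<open>Pascal's rule splits \<open>Suc t choose Suc r\<close> into the summands for
    \<open>j = r\<close> and \<open>j = Suc r\<close>; the subtracted
    \<open>Suc u choose Suc r\<close> exceeds \<open>s\<close>.\<close>
  then have "zrank t (u, r, s) < (\<Sum>j<Suc (Suc r). t choose j)"
    using assms(2) by simp
  also have "\<dots> \<le> 2 ^ t"
    by (rule sum_choose_le)
  finally show ?thesis .
qed

text \<open>Although ranks are positions within one parity class, they also increase along relations
  between classes, so no two comparable elements share a rank.\<close>

lemma zrank_mono:
  assumes "u \<le> t" "s < u choose r" "u' \<le> t" "s' < u' choose r'" "zless (u, r, s) (u', r', s')"
  shows "zrank t (u, r, s) < zrank t (u', r', s')"
proof -
  have le: "Suc u choose Suc r \<le> Suc t choose Suc r"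
    by (intro binomial_right_mono) (use assms(1) in auto)
  \<comment> \<open>Of \<open>Suc u choose Suc r\<close>, the part \<open>u choose r\<close>
    outweighs \<open>s\<close>. The slack \<open>u choose Suc r\<close> that remains pays for the
    step to \<open>r' = Suc r\<close> in the last case.\<close>
  have bound: "zrank t (u, r, s) < (\<Sum>j<Suc (Suc r). t choose j) - (u choose Suc r)"
    using le assms(2) by simp
  consider "r + 2 \<le> r'" | "r' = r" "u' < u" | "r' = r" "u' = u" "s < s'" | "r' = Suc r" "u' \<le> u"
    using assms(5) by force
  then show ?thesis
  proof cases
    case 1
    have "(\<Sum>j<Suc (Suc r). t choose j) \<le> (\<Sum>j<r'. t choose j)"
      using 1 by (intro sum_mono2) auto
    then show ?thesis
      using bound by simp
  next
    case 2
    have "Suc u' choose Suc r \<le> u choose Suc r"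
      by (intro binomial_right_mono) (use 2 in auto)
    then show ?thesis
      using 2 le assms(2) by simp
  next
    case 3
    then show ?thesis by simp
  next
    case 4
    have "u' choose Suc r \<le> u choose Suc r" "u' choose Suc (Suc r) \<le> t choose Suc (Suc r)"
      "u' choose Suc r \<le> t choose Suc r"
      by (intro binomial_right_mono; use 4 assms in simp)+
    then show ?thesis
      using 4(1) bound by simp
  qed
qed

text \<open>Ranks map a chain injectively into the numbers below \<open>2 ^ t\<close>.\<close>

lemma card_zless_chain_le:
  assumes "Y \<subseteq> (\<Union>s\<le>t. zlevel s)" "totalp_on Y zless"
  shows "card Y \<le> 2 ^ t"
proof -
  have Y: "u \<le> t \<and> s < u choose r" if "(u, r, s) \<in> Y" for u r s
    using that assms(1) by (auto simp: zlevel_def)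
  have "inj_on (zrank t) Y"
  proof (rule inj_onI, rule ccontr)
    fix x y
    assume *: "x \<in> Y" "y \<in> Y" "zrank t x = zrank t y" "x \<noteq> y"
    obtain u r s u' r' s' where xy: "x = (u, r, s)" "y = (u', r', s')"
      by (metis prod_cases3)
    have "zless x y \<or> zless y x"
      using * assms(2) by (auto dest: totalp_onD)
    then show False
      using zrank_mono Y * unfolding xy by (metis less_irrefl)
  qed
  moreover have "zrank t ` Y \<subseteq> {..<2 ^ t}"
    using Y zrank_less by fastforce
  ultimately show ?thesis
    using card_inj_on_le[of "zrank t" Y "{..<2 ^ t}"] by simp
qed

lemma finite_zgraph_verts: "finite (\<Union>t<n. zlevel t)"
  by (simp add: finite_zlevel)

lemma dag_zgraph: "dag (zgraph m)"
  unfolding zgraph_def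
  by (rule dag_order_graph[OF finite_zgraph_verts transp_zless irreflp_zless])

lemma card_pverts_zgraph: "card (pverts (zgraph m)) = 2 ^ Suc m - 1"
proof -
  have "card (\<Union>t<Suc m. zlevel t) = (\<Sum>t<Suc m. card (zlevel t))"
    using disjoint_family_zlevel
    by (intro card_UN_disjoint) (auto simp: finite_zlevel disjoint_family_on_def)
  then show ?thesis
    unfolding zgraph_def card_pverts_order_graph card_zlevel
    by (simp only: sum_power2 flip: atLeast0LessThan)
qed

text \<open>Middle coordinates of incomparable triples differ by exactly one, which parity forbids
  for three triples pairwise.\<close>

lemma width_zgraph:
  assumes "m \<ge> 1"
  shows "width (zgraph m) = 2"
proof (rule width_eqI)
  show "finite (pverts (zgraph m))"
    by (simp add: zgraph_def finite_zlevel)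
next
  fix X
  assume "antichain (zgraph m) X"
  then obtain Y where Y: "X = to_nat ` Y" "\<forall>u\<in>Y. \<forall>v\<in>Y. \<not> zless u v"
    unfolding zgraph_def antichain_order_graph_iff[OF transp_zless irreflp_zless] by blast
  have near: "fst (snd x) = Suc (fst (snd y)) \<or> fst (snd y) = Suc (fst (snd x))"
    if "x \<in> Y" "y \<in> Y" "x \<noteq> y" for x y
  proof -
    have "\<not> zless x y" "\<not> zless y x"
      using that Y by auto
    then show ?thesis
      using that(3) by (cases x; cases y) auto
  qed
  have "card Y \<le> 2"
  proof (rule card_le_2I)
    fix x y z
    assume "x \<in> Y" "y \<in> Y" "z \<in> Y" "x \<noteq> y" "y \<noteq> z" "x \<noteq> z"
    then show False
      using near[of x y] near[of y z] near[of x z] by linarith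
  qed
  then show "card X \<le> 2"
    by (simp add: Y(1) card_image)
next
  \<comment> \<open>Level and middle coordinate both increase by one, the incomparable situation;
    \<open>m \<ge> 1\<close> provides level 1.\<close>
  let ?A = "{(0, 0, 0), (1, 1, 0)} :: (nat \<times> nat \<times> nat) set"
  have "?A \<subseteq> (\<Union>t<Suc m. zlevel t)"
    using assms by (force simp: zlevel_def)
  then show "antichain (zgraph m) (to_nat ` ?A)"
    unfolding zgraph_def antichain_order_graph_iff[OF transp_zless irreflp_zless]
    by (intro exI[of _ ?A]) auto
  show "card (to_nat ` ?A) = 2"
    by (simp add: card_image)
qed

lemma greedy_chain_partition_zgraph:
  "greedy_chain_partition (zgraph m) (map (\<lambda>t. to_nat ` zlevel t) (rev [0..<Suc m]))"
proof -
  let ?C = "\<lambda>t. to_nat ` zlevel t"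
  have "greedy_run (chain (zgraph m)) (\<Union>t<Suc m. ?C t) (map ?C (rev [0..<Suc m]))"
  proof (rule greedy_run_levels)
    show "disjoint_family ?C"
      using disjoint_family_zlevel
      by (simp add: disjoint_family_on_def flip: image_Int[OF inj_to_nat])
    fix t
    assume t: "t < Suc m"
    have "zlevel t \<noteq> {}"
      using card_zlevel[of t] by force
    then show "?C t \<noteq> {}"
      by simp
    show "chain (zgraph m) (?C t)"
      unfolding zgraph_def using t \<open>zlevel t \<noteq> {}\<close>
      by (intro chain_order_graphI finite_zgraph_verts transp_zless irreflp_zless totalp_on_zlevel)
        auto
    fix X
    assume X: "X \<subseteq> (\<Union>s\<le>t. ?C s)" "chain (zgraph m) X"
    obtain Y where Y: "X = to_nat ` Y" "totalp_on Y zless"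
      using X(2) unfolding zgraph_def by (rule chain_order_graphE[OF _ transp_zless])
    have "Y \<subseteq> (\<Union>s\<le>t. zlevel s)"
      using X(1) unfolding Y(1) by (simp add: inj_image_subset_iff flip: image_UN)
    then show "card X \<le> card (?C t)"
      using card_zless_chain_le Y by (simp add: card_image card_zlevel)
  qed
  then show ?thesis
    by (simp add: greedy_chain_partition_def zgraph_def image_UN del: upt_Suc)
qed

section \<open>A height-2 order with long greedy antichain partitions\<close>

fun bless :: "nat \<times> bool \<times> nat \<Rightarrow> nat \<times> bool \<times> nat \<Rightarrow> bool" where
  "bless (l, b, i) (l', b', i') \<longleftrightarrow> \<not> b \<and> b' \<and> l \<noteq> l'"

text \<open>By truncated subtraction, each side has one element on level 0 and one on level 1.\<close>
definition bside :: "bool \<Rightarrow> nat \<Rightarrow> (nat \<times> bool \<times> nat) set" where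
  "bside b l = {l} \<times> {b} \<times> {..<2 ^ (l - 1)}"

definition blevel :: "nat \<Rightarrow> (nat \<times> bool \<times> nat) set" where
  "blevel l = bside False l \<union> bside True l"

definition bgraph :: "nat \<Rightarrow> nat pair_pre_digraph" where
  "bgraph m = order_graph (\<Union>l<Suc m. blevel l) bless"

text \<open>Holds vacuously: no element is both above one element and below another.\<close>

lemma transp_bless: "transp bless"
  by (rule transpI) auto

lemma irreflp_bless: "irreflp bless"
  by (rule irreflpI) auto

lemma finite_bside: "finite (bside b l)"
  by (simp add: bside_def)

lemma finite_blevel: "finite (blevel l)"
  by (simp add: blevel_def finite_bside)

lemma card_blevel: "card (blevel l) = 2 * 2 ^ (l - 1)"
  unfolding blevel_def
  by (subst card_Un_disjoint) (auto simp: bside_def card_cartesian_product)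

lemma disjoint_family_blevel: "disjoint_family blevel"
  by (auto simp: disjoint_family_on_def blevel_def bside_def)

text \<open>The doubled size 1 at levels 0 and 1 turns the geometric sum into an exact power, so for
  \<open>m \<ge> 1\<close> one side up to level \<open>m\<close> is as large as both sides of level
  \<open>m\<close>.\<close>

lemma sum_level_sizes: "(\<Sum>l\<le>m. 2 ^ (l - 1)) = (2 ^ m :: nat)"
proof (induction m)
  case (Suc m)
  then show ?case by simp
qed simp

lemma card_Union_bside: "card (\<Union>l\<le>m. bside b l) = 2 ^ m"
proof -
  have "card (\<Union>l\<le>m. bside b l) = (\<Sum>l\<le>m. card (bside b l))"
    by (intro card_UN_disjoint) (auto simp: bside_def)
  also have "\<dots> = (\<Sum>l\<le>m. 2 ^ (l - 1))"
    by (simp add: bside_def card_cartesian_product)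
  finally show ?thesis
    by (simp only: sum_level_sizes)
qed

lemma card_bless_antichain_le:
  assumes "Y \<subseteq> (\<Union>s\<le>l. blevel s)" "\<forall>u\<in>Y. \<forall>v\<in>Y. \<not> bless u v"
  shows "card Y \<le> 2 * 2 ^ (l - 1)"
proof -
  \<comment> \<open>Equality except at \<open>l = 0\<close>, where the right side is 2.\<close>
  have pow: "2 ^ l \<le> 2 * (2 ^ (l - 1) :: nat)"
    by (cases l) auto
  consider b where "Y \<subseteq> (\<Union>s\<le>l. bside b s)"
    | k i k' i' where "(k, False, i) \<in> Y" "(k', True, i') \<in> Y"
  proof (cases "(\<exists>k i. (k, False, i) \<in> Y) \<and> (\<exists>k i. (k, True, i) \<in> Y)")
    case True
    then show thesis
      using that(2) by blast
  next
    case False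
    then obtain b where b: "(k, \<not> b, i) \<notin> Y" for k i
      by (metis (full_types))
    have "c = b" if "(k, c, i) \<in> Y" for k c i
      using that b by (cases c; cases b) auto
    then have "Y \<subseteq> (\<Union>s\<le>l. bside b s)"
      using assms(1) by (fastforce simp: blevel_def bside_def)
    then show thesis
      by (rule that(1))
  qed
  then show ?thesis
  proof cases
    case 1
    then have "card Y \<le> 2 ^ l"
      by (metis card_Union_bside card_mono finite_UN finite_atMost finite_bside)
    with pow show ?thesis by linarith
  next
    case 2
    have "Y \<subseteq> blevel k"
    proof
      fix y
      assume y: "y \<in> Y"
      obtain k'' b i'' where y_eq: "y = (k'', b, i'')"
        by (cases y)
      \<comment> \<open>The lower and the upper witness must share a level; a further element is
        forced onto it by the witness on the opposite side.\<close>
      have "k = k'" "\<not> bless (k, False, i) y" "\<not> bless y (k', True, i')"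
        using bspec[OF bspec[OF assms(2) 2(1)] 2(2)] bspec[OF bspec[OF assms(2) 2(1)] y]
          bspec[OF bspec[OF assms(2) y] 2(2)] by auto
      then have "k'' = k"
        by (cases b) (auto simp: y_eq)
      then show "y \<in> blevel k"
        using y assms(1) by (auto simp: blevel_def bside_def y_eq)
    qed
    moreover have "k \<le> l"
      using 2(1) assms(1) by (auto simp: blevel_def bside_def)
    ultimately have "card Y \<le> 2 * 2 ^ (k - 1)"
      using card_mono[OF finite_blevel, of Y k] by (simp add: card_blevel)
    also have "\<dots> \<le> 2 * 2 ^ (l - 1)"
      using \<open>k \<le> l\<close> by (simp add: diff_le_mono)
    finally show ?thesis .
  qed
qed

lemma finite_bgraph_verts: "finite (\<Union>l<n. blevel l)"
  by (simp add: finite_blevel)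

lemma dag_bgraph: "dag (bgraph m)"
  unfolding bgraph_def
  by (rule dag_order_graph[OF finite_bgraph_verts transp_bless irreflp_bless])

lemma card_pverts_bgraph: "card (pverts (bgraph m)) = 2 ^ Suc m"
proof -
  have "card (\<Union>l<Suc m. blevel l) = (\<Sum>l<Suc m. card (blevel l))"
    using disjoint_family_blevel
    by (intro card_UN_disjoint) (auto simp: finite_blevel disjoint_family_on_def)
  then show ?thesis
    unfolding bgraph_def card_pverts_order_graph card_blevel lessThan_Suc_atMost
    by (simp only: sum_level_sizes power_Suc flip: sum_distrib_left)
qed

text \<open>Comparable elements lie on opposite sides, and there are only two sides.\<close>

lemma height_bgraph:
  assumes "m \<ge> 1"
  shows "height (bgraph m) = 2"
proof (rule height_eqI)
  show "finite (pverts (bgraph m))"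
    by (simp add: bgraph_def finite_blevel)
next
  fix X
  assume "chain (bgraph m) X"
  then obtain Y where Y: "X = to_nat ` Y" "totalp_on Y bless"
    unfolding bgraph_def by (rule chain_order_graphE[OF _ transp_bless])
  have sides: "fst (snd x) \<noteq> fst (snd y)" if "x \<in> Y" "y \<in> Y" "x \<noteq> y" for x y
    using totalp_onD[OF Y(2) that] by (cases x; cases y) auto
  have "card Y \<le> 2"
    by (rule card_le_2I) (use sides in blast)
  then show "card X \<le> 2"
    by (simp add: Y(1) card_image)
next
  \<comment> \<open>Comparability needs two different levels, hence
    \<open>m \<ge> 1\<close>.\<close>
  let ?C = "{(0, False, 0), (1, True, 0)} :: (nat \<times> bool \<times> nat) set"
  have "?C \<subseteq> (\<Union>l<Suc m. blevel l)"
    using assms by (force simp: blevel_def bside_def)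
  then show "chain (bgraph m) (to_nat ` ?C)"
    unfolding bgraph_def
    by (intro chain_order_graphI finite_bgraph_verts transp_bless irreflp_bless)
      (auto simp: totalp_on_def)
  show "card (to_nat ` ?C) = 2"
    by (simp add: card_image)
qed

lemma greedy_antichain_partition_bgraph:
  "greedy_antichain_partition (bgraph m) (map (\<lambda>l. to_nat ` blevel l) (rev [0..<Suc m]))"
proof -
  let ?A = "\<lambda>l. to_nat ` blevel l"
  have "greedy_run (antichain (bgraph m)) (\<Union>l<Suc m. ?A l) (map ?A (rev [0..<Suc m]))"
  proof (rule greedy_run_levels)
    show "disjoint_family ?A"
      using disjoint_family_blevel
      by (simp add: disjoint_family_on_def flip: image_Int[OF inj_to_nat])
    fix l
    assume l: "l < Suc m"
    have "(l, False, 0) \<in> blevel l"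
      by (simp add: blevel_def bside_def)
    then show "?A l \<noteq> {}"
      by blast
    have "\<forall>u\<in>blevel l. \<forall>v\<in>blevel l. \<not> bless u v"
      by (auto simp: blevel_def bside_def)
    then show "antichain (bgraph m) (?A l)"
      unfolding bgraph_def antichain_order_graph_iff[OF transp_bless irreflp_bless]
      using l by blast
    fix X
    assume X: "X \<subseteq> (\<Union>k\<le>l. ?A k)" "antichain (bgraph m) X"
    obtain Y where Y: "X = to_nat ` Y" "\<forall>u\<in>Y. \<forall>v\<in>Y. \<not> bless u v"
      using X(2) unfolding bgraph_def antichain_order_graph_iff[OF transp_bless irreflp_bless]
      by blast
    have "Y \<subseteq> (\<Union>k\<le>l. blevel k)"
      using X(1) unfolding Y(1) by (simp add: inj_image_subset_iff flip: image_UN)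
    then show "card X \<le> card (?A l)"
      using card_bless_antichain_le Y by (simp add: card_image card_blevel)
  qed
  then show ?thesis
    by (simp add: greedy_antichain_partition_def bgraph_def image_UN del: upt_Suc)
qed

section \<open>The two families\<close>

lemma le_two_power_diff_1: "m \<le> 2 ^ Suc m - (1 :: nat)"
  using less_exp[of m] unfolding power_Suc by linarith

theorem theorem5:
  shows "(\<exists>\<F> :: nat pair_pre_digraph set.
            infinite \<F> \<and> (\<forall>N. \<exists>G\<in>\<F>. N \<le> card (pverts G)) \<and>
            (\<forall>G\<in>\<F>. dag G \<and> width G = 2 \<and>
              (\<exists>Cs. greedy_chain_partition G Cs \<and>
                 real (length Cs) \<ge> real (width G) * log 4 (real (card (pverts G))))))
       \<and> (\<exists>\<F> :: nat pair_pre_digraph set.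
            infinite \<F> \<and> (\<forall>N. \<exists>G\<in>\<F>. N \<le> card (pverts G)) \<and>
            (\<forall>G\<in>\<F>. dag G \<and> height G = 2 \<and>
              (\<exists>As. greedy_antichain_partition G As \<and>
                 real (length As) \<ge> real (height G) * log 4 (real (card (pverts G))))))"
proof (intro conjI)
  \<comment> \<open>The index 0 is left out: \<open>zgraph 0\<close> is a single vertex, of width
    1.\<close>
  let ?F = "zgraph ` {1..}"
  have unb: "\<exists>G\<in>?F. N \<le> card (pverts G)" for N
  proof
    show "N \<le> card (pverts (zgraph (Suc N)))"
      using le_two_power_diff_1[of "Suc N"] unfolding card_pverts_zgraph by linarith
  qed simp
  have "dag G \<and> width G = 2 \<and> (\<exists>Cs. greedy_chain_partition G Cs \<and>
      real (length Cs) \<ge> real (width G) * log 4 (real (card (pverts G))))" if G: "G \<in> ?F" for G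
  proof -
    obtain m where m: "m \<ge> 1" "G = zgraph m"
      using G by auto
    have "2 * log 4 (real (card (pverts (zgraph m)))) \<le> real (Suc m)"
      by (rule two_times_log_4_le) (simp only: card_pverts_zgraph diff_le_self)
    then show ?thesis
      using m dag_zgraph width_zgraph greedy_chain_partition_zgraph[of m]
      by (auto intro!: exI[of _ "map (\<lambda>t. to_nat ` zlevel t) (rev [0..<Suc m])"] simp del: upt_Suc)
  qed
  then show "\<exists>\<F> :: nat pair_pre_digraph set.
            infinite \<F> \<and> (\<forall>N. \<exists>G\<in>\<F>. N \<le> card (pverts G)) \<and>
            (\<forall>G\<in>\<F>. dag G \<and> width G = 2 \<and>
              (\<exists>Cs. greedy_chain_partition G Cs \<and>
                 real (length Cs) \<ge> real (width G) * log 4 (real (card (pverts G)))))"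
    using unb infinite_if_card_pverts_unbounded[OF unb] by blast
next
  let ?F = "bgraph ` {1..}"
  have unb: "\<exists>G\<in>?F. N \<le> card (pverts G)" for N
  proof
    show "N \<le> card (pverts (bgraph (Suc N)))"
      using le_two_power_diff_1[of "Suc N"] unfolding card_pverts_bgraph by linarith
  qed simp
  have "dag G \<and> height G = 2 \<and> (\<exists>As. greedy_antichain_partition G As \<and>
      real (length As) \<ge> real (height G) * log 4 (real (card (pverts G))))" if G: "G \<in> ?F" for G
  proof -
    obtain m where m: "m \<ge> 1" "G = bgraph m"
      using G by auto
    \<comment> \<open>With exactly \<open>2 ^ Suc m\<close> vertices this is an equality.\<close>
    have "2 * log 4 (real (card (pverts (bgraph m)))) \<le> real (Suc m)"
      by (rule two_times_log_4_le) (simp only: card_pverts_bgraph order_refl)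
    then show ?thesis
      using m dag_bgraph height_bgraph greedy_antichain_partition_bgraph[of m]
      by (auto intro!: exI[of _ "map (\<lambda>l. to_nat ` blevel l) (rev [0..<Suc m])"] simp del: upt_Suc)
  qed
  then show "\<exists>\<F> :: nat pair_pre_digraph set.
            infinite \<F> \<and> (\<forall>N. \<exists>G\<in>\<F>. N \<le> card (pverts G)) \<and>
            (\<forall>G\<in>\<F>. dag G \<and> height G = 2 \<and>
              (\<exists>As. greedy_antichain_partition G As \<and>
                 real (length As) \<ge> real (height G) * log 4 (real (card (pverts G)))))"
    using unb infinite_if_card_pverts_unbounded[OF unb] by blast
qed

end
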